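(* Let $G$ be a graph of order $n\ge 2$ with vertices $v_1,\dots,v_n$ and Seidel matrix $S=S(G)$. Then for every vertex $v_i$, $$\mathcal{E}_S(v_i)\ge\frac{(n-1)^{3/2}}{\sqrt{[S^4]_{ii}}},$$ where $[S^4]_{ii}$ denotes the $i$-th diagonal entry of $S^4$.
   Context: All graphs are finite, simple and undirected. The Seidel matrix of a graph $G$ with vertex set $\{v_1,\dots,v_n\}$ is the real symmetric $n\times n$ matrix $S(G)=[s_{ij}]$ with $s_{ii}=0$, and for $i\neq j$, $s_{ij}=-1$ if $v_i$ and $v_j$ are adjacent and $s_{ij}=1$ otherwise. For a real symmetric matrix $S$, $|S|=(S^2)^{1/2}$ is the positive semidefinite square root of $S^2$. The vertex Seidel energy of $v_i$ is $\mathcal{E}_S(v_i)=|S(G)|_{ii}$, the $i$-th diagonal entry of $|S(G)|$. *)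

theory Defs
  imports "HOL-Analysis.Analysis" "Graph_Theory.Graph_Theory"
begin

text \<open>
  The finite index type \<open>'n\<close> plays the role of \<open>{1, ..., n}\<close>, and \<open>v :: 'n \<Rightarrow> 'a\<close> is the enumeration
  \<open>v\<^sub>1, ..., v\<^sub>n\<close> of the vertices. Finite simple undirected graphs are \<^locale>\<open>pair_graph\<close>s: finite,
  loopless and with a symmetric set of arcs.
\<close>

definition seidel_matrix :: "'a pair_pre_digraph \<Rightarrow> ('n::finite \<Rightarrow> 'a) \<Rightarrow> real^'n^'n" where
  "seidel_matrix G v =
     (\<chi> i j. if i = j then 0 else if (v i, v j) \<in> parcs G then -1 else 1)"

(* The class operation ^ on real^'n^'n is the entrywise power, hence not usable here. *)
primrec mat_pow :: "real^'n^'n \<Rightarrow> nat \<Rightarrow> real^'n^'n" where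
  "mat_pow A 0 = mat 1"
| "mat_pow A (Suc k) = A ** mat_pow A k"

(* Over the reals, symmetry does not follow from nonnegativity of the quadratic form. *)
definition pos_semidef :: "real^'n^'n \<Rightarrow> bool" where
  "pos_semidef A \<longleftrightarrow> transpose A = A \<and> (\<forall>x. 0 \<le> x \<bullet> (A *v x))"

(* Meaningful only for positive semidefinite A, where the root exists and is unique. *)
definition psd_sqrt :: "real^'n^'n \<Rightarrow> real^'n^'n" where
  "psd_sqrt A = (THE P. pos_semidef P \<and> mat_pow P 2 = A)"

definition mat_abs :: "real^'n^'n \<Rightarrow> real^'n^'n" where
  "mat_abs A = psd_sqrt (mat_pow A 2)"

definition vertex_seidel_energy :: "'a pair_pre_digraph \<Rightarrow> ('n::finite \<Rightarrow> 'a) \<Rightarrow> 'n \<Rightarrow> real" where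
  "vertex_seidel_energy G v i = mat_abs (seidel_matrix G v) $ i $ i"

end

theory Submission
  imports Defs
begin

text \<open>
  Write \<open>P = |S|\<close> and \<open>m\<^sub>k = [P\<^sup>k]\<^sub>i\<^sub>i\<close>. The Cauchy-Schwarz inequality for the semi-inner product
  \<open>x \<bullet> P y\<close> gives \<open>m\<^sub>2\<^sup>2 \<le> m\<^sub>1 m\<^sub>3\<close>, the ordinary one gives \<open>m\<^sub>3\<^sup>2 \<le> m\<^sub>2 m\<^sub>4\<close>, and together
  \<open>m\<^sub>2\<^sup>3 \<le> m\<^sub>1\<^sup>2 m\<^sub>4\<close>. Here \<open>m\<^sub>2 = [S\<^sup>2]\<^sub>i\<^sub>i = n - 1\<close> and \<open>m\<^sub>4 = [S\<^sup>4]\<^sub>i\<^sub>i\<close>.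

  The existence of \<open>P\<close> is obtained without the spectral theorem: if \<open>Q\<close> maximises the trace of
  \<open>S Q\<close> over the compact orthogonal group, then comparing \<open>Q\<close> with its products with one or two
  reflections shows that \<open>P = S Q\<close> is positive semidefinite, and \<open>P\<^sup>2 = P P\<^sup>T = S S\<^sup>T\<close>.
\<close>

section \<open>Positive semidefinite matrices\<close>

lemma inner_matrix_vector_transpose:
  fixes A :: "real^'n^'m"
  shows "(A *v x) \<bullet> y = x \<bullet> (transpose A *v y)"
  by (metis dot_lmul_matrix inner_commute vector_transpose_matrix transpose_transpose)

lemma pos_semidef_symmetric:
  "pos_semidef P \<Longrightarrow> (P *v x) \<bullet> y = x \<bullet> (P *v y)"
  by (simp add: inner_matrix_vector_transpose pos_semidef_def)

text \<open>At \<open>(c, - b)\<close> and \<open>(b, - a)\<close> the form takes the values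
  \<open>c * (a * c - b\<^sup>2)\<close> and \<open>a * (a * c - b\<^sup>2)\<close>, which settles
  the case of a nonzero \<open>a\<close> or \<open>c\<close>. If both vanish, \<open>(1, 1)\<close>
  and \<open>(1, -1)\<close> force \<open>b = 0\<close>.\<close>

lemma discriminant_nonpos:
  fixes a b c :: real
  assumes "\<And>s t. 0 \<le> s\<^sup>2 * a + 2 * s * t * b + t\<^sup>2 * c"
  shows "b\<^sup>2 \<le> a * c"
proof -
  have nn: "a \<ge> 0" "c \<ge> 0"
    using assms[of 1 0] assms[of 0 1] by auto
  have "0 \<le> c * (a * c - b\<^sup>2)" "0 \<le> a * (a * c - b\<^sup>2)"
    using assms[of c "- b"] assms[of b "- a"] by (auto simp: algebra_simps power2_eq_square)
  moreover have "b = 0" if "a = 0" "c = 0"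
    using assms[of 1 1] assms[of 1 "-1"] that by simp
  ultimately show ?thesis
    using nn by (cases "a = 0"; cases "c = 0") (auto simp: zero_le_mult_iff mult_le_0_iff)
qed

lemma pos_semidef_Cauchy_Schwarz:
  assumes "pos_semidef P"
  shows "(x \<bullet> (P *v y))\<^sup>2 \<le> (x \<bullet> (P *v x)) * (y \<bullet> (P *v y))"
proof (rule discriminant_nonpos)
  fix s t :: real
  have "0 \<le> (s *\<^sub>R x + t *\<^sub>R y) \<bullet> (P *v (s *\<^sub>R x + t *\<^sub>R y))"
    using assms by (simp add: pos_semidef_def)
  also have "\<dots> = s\<^sup>2 * (x \<bullet> (P *v x)) + 2 * s * t * (x \<bullet> (P *v y)) + t\<^sup>2 * (y \<bullet> (P *v y))"
    using pos_semidef_symmetric[OF assms, of x y]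
    by (simp add: matrix_vector_right_distrib matrix_vector_mult_scaleR inner_add_left
        inner_add_right inner_commute algebra_simps power2_eq_square)
  finally show "0 \<le> s\<^sup>2 * (x \<bullet> (P *v x)) + 2 * s * t * (x \<bullet> (P *v y)) + t\<^sup>2 * (y \<bullet> (P *v y))" .
qed

text \<open>Cauchy-Schwarz for the form of \<open>P\<close>, applied to \<open>P *v x\<close> and
  \<open>x\<close>, bounds the fourth power of the norm of \<open>P *v x\<close> by a multiple of
  \<open>x \<bullet> (P *v x)\<close>.\<close>

lemma pos_semidef_kernel:
  assumes "pos_semidef P" "x \<bullet> (P *v x) = 0"
  shows "P *v x = 0"
  using pos_semidef_Cauchy_Schwarz[OF assms(1), of "P *v x" x] assms(2) by simp

lemma matrix_entry_inner: "A $ i $ j = axis i 1 \<bullet> (A *v axis j 1)"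
  for A :: "real^'n^'n"
  by (simp add: inner_axis' matrix_vector_mult_basis column_def)

lemma pos_semidef_diag_nonneg: "pos_semidef P \<Longrightarrow> 0 \<le> P $ i $ i"
  by (simp add: matrix_entry_inner pos_semidef_def)

lemma transpose_diff: "transpose (A - B) = transpose A - transpose B"
  for A B :: "real^'n^'m"
  by (simp add: transpose_def vec_eq_iff)

lemma matrix_diff_ldistrib: "A ** (B - C) = A ** B - A ** C"
  for A B C :: "real^'n^'n"
  by (simp add: matrix_matrix_mult_def vec_eq_iff sum_subtractf algebra_simps)

lemma matrix_diff_rdistrib: "(B - C) ** A = B ** A - C ** A"
  for A B C :: "real^'n^'n"
  by (simp add: matrix_matrix_mult_def vec_eq_iff sum_subtractf algebra_simps)

lemma matrix_conj_diag:
  fixes D P :: "real^'n^'n"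
  assumes "transpose D = D"
  shows "(D ** P ** D) $ i $ i = (D *v axis i 1) \<bullet> (P *v (D *v axis i 1))"
  using assms
  by (simp add: matrix_entry_inner inner_matrix_vector_transpose flip: matrix_vector_mul_assoc)

text \<open>
  With \<open>D = P - R\<close> one has \<open>P D = - D R\<close>, so \<open>D P D\<close> and \<open>D R D\<close>, both positive semidefinite, have
  opposite traces. Hence \<open>P\<close> and \<open>R\<close> vanish on the range of \<open>D\<close>, that is \<open>D\<^sup>2 = 0\<close>.
\<close>
lemma pos_semidef_root_unique:
  fixes P R :: "real^'n^'n"
  assumes P: "pos_semidef P" and R: "pos_semidef R" and eq: "P ** P = R ** R"
  shows "P = R"
proof -
  define D where "D = P - R"
  have D: "transpose D = D"
    using P R by (simp add: D_def transpose_diff pos_semidef_def)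
  have "P ** D + D ** R = 0"
    by (simp add: D_def matrix_diff_ldistrib matrix_diff_rdistrib eq)
  then have "trace (D ** (P ** D + D ** R)) = 0"
    by (simp add: trace_0[unfolded mat_0])
  \<comment> \<open>Cyclicity of the trace turns \<open>D ** (D ** R)\<close> into
    \<open>D ** R ** D\<close>.\<close>
  then have "trace (D ** P ** D) + trace (D ** R ** D) = 0"
    using trace_mul_sym[of D "D ** R"] by (simp add: matrix_add_ldistrib trace_add matrix_mul_assoc)
  then have sum0: "(\<Sum>i\<in>UNIV. (D ** P ** D) $ i $ i + (D ** R ** D) $ i $ i) = 0"
    by (simp add: trace_def sum.distrib)
  have nn: "0 \<le> (D ** P ** D) $ i $ i" "0 \<le> (D ** R ** D) $ i $ i" for i
    using P R by (simp_all add: matrix_conj_diag[OF D] pos_semidef_def)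
  have "D *v axis i 1 = 0" for i
  proof -
    let ?x = "D *v axis i 1"
    have "(D ** P ** D) $ i $ i + (D ** R ** D) $ i $ i = 0"
      using sum0 nn by (subst (asm) sum_nonneg_eq_0_iff) (auto intro: add_nonneg_nonneg)
    then have "?x \<bullet> (P *v ?x) = 0" "?x \<bullet> (R *v ?x) = 0"
      using nn[of i] by (simp_all flip: matrix_conj_diag[OF D])
    then have "P *v ?x = 0" "R *v ?x = 0"
      using P R by (simp_all add: pos_semidef_kernel)
    then have "D *v ?x = 0"
      by (simp add: D_def matrix_vector_mult_diff_rdistrib)
    then have "?x \<bullet> ?x = 0"
      using D by (simp add: inner_matrix_vector_transpose)
    then show ?thesis by simp
  qed
  then have "D $ k $ i = 0" for k i
    by (simp only: matrix_entry_inner inner_zero_right)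
  then have "D = 0"
    by (simp add: vec_eq_iff)
  then show ?thesis by (simp add: D_def)
qed

section \<open>Existence of the square root\<close>

text \<open>The Householder reflection in the hyperplane orthogonal to \<open>u\<close>. For
  \<open>u = 0\<close> it is the identity, so the facts below need no case
  \<open>u \<noteq> 0\<close> in their statements.\<close>

definition reflection :: "real^'n \<Rightarrow> real^'n^'n" where
  "reflection u = (\<chi> i j. (if i = j then 1 else 0) - 2 / (u \<bullet> u) * u $ i * u $ j)"

lemma reflection_mult: "reflection u *v x = x - (2 / (u \<bullet> u) * (u \<bullet> x)) *\<^sub>R u"
proof -
  have sum: "(\<Sum>j\<in>UNIV. ((if i = j then 1 else 0) - c * u $ i * u $ j) * x $ j)
      = x $ i - c * (u \<bullet> x) * u $ i" for i and c :: real
  proof -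
    have "(\<Sum>j\<in>UNIV. ((if i = j then 1 else 0) - c * u $ i * u $ j) * x $ j)
        = (\<Sum>j\<in>UNIV. (if i = j then x $ j else 0) - c * u $ i * (u $ j * x $ j))"
      by (intro sum.cong) (auto simp: algebra_simps)
    also have "\<dots> = x $ i - c * u $ i * (\<Sum>j\<in>UNIV. u $ j * x $ j)"
      by (simp add: sum_subtractf sum_distrib_left)
    finally show ?thesis by (simp add: inner_vec_def mult_ac)
  qed
  show ?thesis
    using sum[of _ "2 / (u \<bullet> u)"] by (simp add: reflection_def matrix_vector_mult_def vec_eq_iff)
qed

lemma orthogonal_matrix_reflection: "orthogonal_matrix (reflection u)"
proof -
  have "transpose (reflection u) = reflection u"
    by (auto simp: reflection_def transpose_def vec_eq_iff)
  moreover have "reflection u *v (reflection u *v x) = x" for x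
  proof (cases "u = 0")
    case False
    \<comment> \<open>The reflection negates the component along \<open>u\<close>, so a second
      application restores \<open>x\<close>.\<close>
    then have "2 / (u \<bullet> u) * (u \<bullet> (reflection u *v x)) = - (2 / (u \<bullet> u) * (u \<bullet> x))"
      by (simp add: reflection_mult inner_diff_right field_simps)
    then show ?thesis
      by (simp only: reflection_mult[of u "reflection u *v x"]) (simp add: reflection_mult)
  qed (simp add: reflection_mult)
  ultimately show ?thesis
    by (simp add: orthogonal_matrix matrix_eq flip: matrix_vector_mul_assoc)
qed

text \<open>The reflection is the identity minus a multiple of the rank-one matrix of
  \<open>u\<close>, and the trace of \<open>A\<close> times that matrix is the quadratic form of
  \<open>A\<close> at \<open>u\<close>.\<close>

lemma trace_mult_reflection:
  "trace (A ** reflection u) = trace A - 2 / (u \<bullet> u) * (u \<bullet> (A *v u))"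
proof -
  have "trace (A ** reflection u) = (\<Sum>i\<in>UNIV. axis i 1 \<bullet> (A *v (reflection u *v axis i 1)))"
    by (simp add: trace_def matrix_entry_inner matrix_vector_mul_assoc)
  also have "\<dots> = (\<Sum>i\<in>UNIV. A $ i $ i - 2 / (u \<bullet> u) * (u $ i * (A *v u) $ i))"
    by (intro sum.cong refl, simp only: reflection_mult matrix_vector_mult_diff_distrib
        matrix_vector_mult_scaleR inner_diff_right matrix_entry_inner)
      (simp add: inner_axis inner_axis')
  also have "\<dots> = trace A - 2 / (u \<bullet> u) * (u \<bullet> (A *v u))"
    by (simp add: trace_def sum_subtractf inner_vec_def sum_distrib_left)
  finally show ?thesis .
qed

lemma linear_term_eq_0:
  fixes d s :: real
  assumes "\<And>e. 0 \<le> e * d + e\<^sup>2 * s"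
  shows "d = 0"
proof (rule ccontr)
  assume d: "d \<noteq> 0"
  \<comment> \<open>For the small step \<open>e = - d / k\<close> with \<open>k > s\<close>, the
    linear term outweighs the quadratic one.\<close>
  define k where "k = \<bar>s\<bar> + 1"
  have k: "k > 0" "s < k" by (auto simp: k_def)
  have "0 \<le> (- d / k) * d + (- d / k)\<^sup>2 * s" by (rule assms)
  also have "\<dots> = (d / k)\<^sup>2 * (s - k)"
    using k by (simp add: field_simps power2_eq_square)
  also have "\<dots> < 0" using k d by (simp add: mult_pos_neg)
  finally show False by simp
qed

lemma pos_semidef_if_trace_maximal:
  fixes M :: "real^'n^'n"
  assumes max: "\<And>K. orthogonal_matrix K \<Longrightarrow> trace (M ** K) \<le> trace M"
  shows "pos_semidef M"
proof -
  have "0 \<le> x \<bullet> (M *v x)" for x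
  proof (cases "x = 0")
    case False
    then have "2 / (x \<bullet> x) > 0" by simp
    moreover have "0 \<le> 2 / (x \<bullet> x) * (x \<bullet> (M *v x))"
      using max[OF orthogonal_matrix_reflection[of x]] by (simp add: trace_mult_reflection)
    ultimately show ?thesis by (metis zero_le_mult_iff not_less)
  qed simp
  moreover have "M $ i $ j = M $ j $ i" if ij: "i \<noteq> j" for i j
  proof -
    have "0 \<le> e * (M $ i $ j - M $ j $ i) + e\<^sup>2 * (M $ i $ i + M $ j $ j)" for e
    proof -
      \<comment> \<open>The two reflections compose to a rotation in the plane of the axes
        \<open>i\<close> and \<open>j\<close>, which is the identity at \<open>e = 0\<close>.
        Symmetry of \<open>M\<close> is the first-order condition for a maximum there.\<close>
      define u w where "u = (axis i 1 :: real^'n)" and "w = (axis i 1 :: real^'n) + e *\<^sub>R axis j 1"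
      have uu: "u \<bullet> u = 1" and uw: "u \<bullet> w = 1"
        using ij by (simp_all add: u_def w_def inner_add_right inner_axis_axis)
      have ww: "w \<bullet> w = 1 + e\<^sup>2"
        using ij by (simp add: w_def inner_add_right inner_add_left inner_axis_axis power2_eq_square)
      have wMw: "w \<bullet> (M *v w) = M $ i $ i + e * (M $ i $ j + M $ j $ i) + e\<^sup>2 * M $ j $ j"
        by (simp add: w_def matrix_vector_right_distrib matrix_vector_mult_scaleR inner_add_left
            inner_add_right algebra_simps power2_eq_square flip: matrix_entry_inner)
      have wMu: "w \<bullet> (M *v u) = M $ i $ i + e * M $ j $ i"
        by (simp add: w_def u_def inner_add_left flip: matrix_entry_inner)
      have uMu: "u \<bullet> (M *v u) = M $ i $ i"
        by (simp add: u_def flip: matrix_entry_inner)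
      have "trace (M ** reflection u ** reflection w) \<le> trace M"
        using max[OF orthogonal_matrix_mul[OF orthogonal_matrix_reflection orthogonal_matrix_reflection]]
        by (simp add: matrix_mul_assoc)
      \<comment> \<open>Here \<open>reflection u *v w = w - 2 *\<^sub>R u\<close>, because
        \<open>u \<bullet> u = u \<bullet> w = 1\<close>.\<close>
      then have "0 \<le> 2 * (u \<bullet> (M *v u))
          + 2 / (1 + e\<^sup>2) * (w \<bullet> (M *v w) - 2 * (w \<bullet> (M *v u)))"
        by (simp add: trace_mult_reflection uu ww uw reflection_mult matrix_vector_mult_diff_distrib
            matrix_vector_mult_scaleR inner_diff_right flip: matrix_vector_mul_assoc)
      \<comment> \<open>Clearing the denominator leaves a quadratic polynomial in \<open>e\<close>
        without constant term.\<close>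
      then have "0 \<le> (1 + e\<^sup>2) / 2 * (2 * (u \<bullet> (M *v u))
          + 2 / (1 + e\<^sup>2) * (w \<bullet> (M *v w) - 2 * (w \<bullet> (M *v u))))"
        by (intro mult_nonneg_nonneg) auto
      also have "\<dots> = (1 + e\<^sup>2) * (u \<bullet> (M *v u)) + (w \<bullet> (M *v w) - 2 * (w \<bullet> (M *v u)))"
      proof -
        have "1 + e\<^sup>2 \<noteq> 0"
          by (metis add_pos_nonneg less_irrefl zero_le_power2 zero_less_one)
        moreover have "c / 2 * (2 * a + 2 / c * b) = c * a + b" if "c \<noteq> 0" for a b c :: real
          using that by (simp add: field_simps)
        ultimately show ?thesis by blast
      qed
      finally show ?thesis
        by (simp add: wMw wMu uMu algebra_simps)
    qed
    then show ?thesis using linear_term_eq_0 by fastforce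
  qed
  then have "transpose M = M"
    by (auto simp: transpose_def vec_eq_iff) metis
  ultimately show ?thesis by (simp add: pos_semidef_def)
qed

text \<open>Unit rows give boundedness; the equation \<open>transpose Q ** Q = mat 1\<close> is a
  closed condition.\<close>

lemma compact_orthogonal_matrices: "compact {Q :: real^'n^'n. orthogonal_matrix Q}"
proof -
  have "norm Q \<le> real CARD('n)" if "orthogonal_matrix Q" for Q :: "real^'n^'n"
  proof -
    have "norm (Q $ i) = 1" for i
      using that by (simp add: orthogonal_matrix_orthonormal_rows row_def)
    then show ?thesis
      using L2_set_le_sum[of UNIV "\<lambda>i. norm (Q $ i)"] by (simp add: norm_vec_def)
  qed
  then have "bounded {Q :: real^'n^'n. orthogonal_matrix Q}"
    by (auto simp: bounded_iff)
  moreover have "closed {Q :: real^'n^'n. orthogonal_matrix Q}"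
    unfolding orthogonal_matrix matrix_matrix_mult_def transpose_def
    by (intro closed_Collect_eq continuous_intros)
  ultimately show ?thesis by (simp add: compact_eq_bounded_closed)
qed

lemma pos_semidef_root_exists:
  fixes S :: "real^'n^'n"
  obtains P where "pos_semidef P" "P ** P = S ** transpose S"
proof -
  have "continuous_on {Q. orthogonal_matrix Q} (\<lambda>Q. trace (S ** Q))"
    unfolding trace_def matrix_matrix_mult_def by (intro continuous_intros)
  moreover have "{Q :: real^'n^'n. orthogonal_matrix Q} \<noteq> {}"
    using orthogonal_matrix_id by blast
  ultimately obtain Q where Q: "orthogonal_matrix Q"
    and max: "\<And>K. orthogonal_matrix K \<Longrightarrow> trace (S ** K) \<le> trace (S ** Q)"
    using continuous_attains_sup[OF compact_orthogonal_matrices] by (metis mem_Collect_eq)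
  \<comment> \<open>As \<open>Q ** K\<close> is again orthogonal, maximality of \<open>Q\<close> for
    \<open>S\<close> becomes maximality of the identity for \<open>S ** Q\<close>.\<close>
  have "trace (S ** Q ** K) \<le> trace (S ** Q)" if "orthogonal_matrix K" for K
    using max[OF orthogonal_matrix_mul[OF Q that]] by (simp add: matrix_mul_assoc)
  then have P: "pos_semidef (S ** Q)"
    by (rule pos_semidef_if_trace_maximal)
  then have "(S ** Q) ** (S ** Q) = (S ** Q) ** transpose (S ** Q)"
    by (simp add: pos_semidef_def)
  also have "\<dots> = S ** (Q ** transpose Q) ** transpose S"
    by (simp add: matrix_transpose_mul matrix_mul_assoc)
  also have "\<dots> = S ** transpose S"
    using Q by (simp add: orthogonal_matrix_def)
  finally show thesis using that P by blast
qed

section \<open>Matrix powers and the absolute value\<close>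

lemma mat_pow_2: "mat_pow A 2 = A ** A"
  by (simp add: numeral_2_eq_2)

lemma mat_pow_4: "mat_pow A 4 = mat_pow A 2 ** mat_pow A 2"
  by (simp add: numeral_eq_Suc matrix_mul_assoc)

text \<open>Existence and uniqueness of the root justify the definite description in
  \<open>psd_sqrt\<close>; symmetry identifies \<open>S ** transpose S\<close> with the square of
  \<open>S\<close>.\<close>

lemma mat_abs_root:
  fixes S :: "real^'n^'n"
  assumes "transpose S = S"
  shows "pos_semidef (mat_abs S)" "mat_pow (mat_abs S) 2 = mat_pow S 2"
proof -
  obtain P where "pos_semidef P" "P ** P = S ** transpose S"
    using pos_semidef_root_exists by blast
  then have "\<exists>!P. pos_semidef P \<and> mat_pow P 2 = mat_pow S 2"
    using assms by (intro ex1I[of _ P]) (auto simp: mat_pow_2 intro: pos_semidef_root_unique)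
  from theI'[OF this]
  show "pos_semidef (mat_abs S)" "mat_pow (mat_abs S) 2 = mat_pow S 2"
    by (simp_all add: mat_abs_def psd_sqrt_def)
qed

section \<open>The moment inequality\<close>

lemma pos_semidef_moments:
  fixes P :: "real^'n^'n"
  assumes P: "pos_semidef P"
  shows "(mat_pow P 2 $ i $ i) ^ 3 \<le> (P $ i $ i)\<^sup>2 * mat_pow P 4 $ i $ i"
proof -
  define e where "e = (axis i 1 :: real^'n)"
  define x y where "x = P *v e" and "y = P *v x"
  define m3 where "m3 = x \<bullet> y"
  have m1: "P $ i $ i = e \<bullet> x" and m2: "mat_pow P 2 $ i $ i = x \<bullet> x"
    and m4: "mat_pow P 4 $ i $ i = y \<bullet> y"
    by (simp_all add: matrix_entry_inner mat_pow_4 mat_pow_2 e_def x_def y_def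
        pos_semidef_symmetric[OF P] flip: matrix_vector_mul_assoc)
  have "(x \<bullet> x)\<^sup>2 \<le> (e \<bullet> x) * m3"
    using pos_semidef_Cauchy_Schwarz[OF P, of e x] pos_semidef_symmetric[OF P, of e x]
    by (simp add: m3_def x_def y_def)
  then have "((x \<bullet> x)\<^sup>2)\<^sup>2 \<le> (e \<bullet> x)\<^sup>2 * m3\<^sup>2"
    by (metis power_mono power_mult_distrib zero_le_power2)
  also have "\<dots> \<le> (e \<bullet> x)\<^sup>2 * ((x \<bullet> x) * (y \<bullet> y))"
    by (simp add: m3_def Cauchy_Schwarz_ineq mult_left_mono)
  \<comment> \<open>Both sides carry a factor \<open>x \<bullet> x\<close>. It cancels unless
    \<open>x = 0\<close>, when both sides of the reduced inequality are 0.\<close>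
  finally have "(x \<bullet> x) * (x \<bullet> x) ^ 3 \<le> (x \<bullet> x) * ((e \<bullet> x)\<^sup>2 * (y \<bullet> y))"
    by (simp add: algebra_simps flip: power_mult power_Suc)
  then have "(x \<bullet> x) ^ 3 \<le> (e \<bullet> x)\<^sup>2 * (y \<bullet> y)"
    by (cases "x = 0") (simp_all add: mult_le_cancel_left)
  then show ?thesis by (simp add: m1 m2 m4)
qed

section \<open>Seidel matrices and the energy bound\<close>

lemma transpose_seidel_matrix:
  assumes "pair_graph G"
  shows "transpose (seidel_matrix G v) = seidel_matrix G v"
proof -
  interpret pair_graph G by fact
  have "(a, b) \<in> parcs G \<longleftrightarrow> (b, a) \<in> parcs G" for a b
    using arcs_symmetric by blast
  then show ?thesis by (auto simp: seidel_matrix_def transpose_def vec_eq_iff)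
qed

text \<open>By symmetry the diagonal entry is the sum of the squares of row \<open>i\<close>, whose
  off-diagonal entries are all 1 or -1.\<close>

lemma seidel_matrix_square_diag:
  fixes v :: "'n::finite \<Rightarrow> 'a"
  assumes "pair_graph G"
  shows "mat_pow (seidel_matrix G v) 2 $ i $ i = real CARD('n) - 1"
proof -
  let ?S = "seidel_matrix G v"
  have "?S $ j $ i = ?S $ i $ j" for j
    using transpose_seidel_matrix[OF assms, of v] by (metis transpose_def vec_lambda_beta)
  then have "mat_pow ?S 2 $ i $ i = (\<Sum>j\<in>UNIV. (?S $ i $ j)\<^sup>2)"
    by (simp add: mat_pow_2 matrix_matrix_mult_def power2_eq_square)
  also have "\<dots> = (\<Sum>j\<in>UNIV. 1 - (if i = j then 1 else 0))"
    by (intro sum.cong) (auto simp: seidel_matrix_def)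
  also have "\<dots> = real CARD('n) - 1"
    by (simp add: sum_subtractf)
  finally show ?thesis .
qed

theorem theorem4:
  fixes G :: "'a pair_pre_digraph" and v :: "'n::finite \<Rightarrow> 'a" and n :: nat and i :: 'n
  assumes "pair_graph G"
    and "n = card (pverts G)" and "n \<ge> 2"
    and "bij_betw v UNIV (pverts G)"
  shows "vertex_seidel_energy G v i
           \<ge> (real n - 1) powr (3 / 2) / sqrt (mat_pow (seidel_matrix G v) 4 $ i $ i)"
proof -
  define S where "S = seidel_matrix G v"
  define P where "P = mat_abs S"
  define m4 where "m4 = mat_pow S 4 $ i $ i"
  have S: "transpose S = S"
    using assms(1) by (simp add: S_def transpose_seidel_matrix)
  have P: "pos_semidef P" and PS: "mat_pow P 2 = mat_pow S 2"
    using mat_abs_root[OF S] by (simp_all add: P_def)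
  have "n = CARD('n)"
    using assms(2,4) by (simp add: bij_betw_same_card)
  then have m2: "mat_pow P 2 $ i $ i = real n - 1"
    using assms(1) by (simp add: PS S_def seidel_matrix_square_diag)
  have "mat_pow P 4 $ i $ i = m4"
    by (simp add: m4_def mat_pow_4 PS)
  then have le: "(real n - 1) ^ 3 \<le> (P $ i $ i)\<^sup>2 * m4"
    using pos_semidef_moments[OF P, of i] m2 by simp
  have n: "real n - 1 > 0" using assms(3) by simp
  \<comment> \<open>The moment inequality itself yields \<open>m4 > 0\<close>, which permits
    division by \<open>sqrt m4\<close> at the end.\<close>
  then have "(P $ i $ i)\<^sup>2 * m4 > 0"
    using le by (meson less_le_trans zero_less_power)
  then have m4: "m4 > 0"
    by (simp add: zero_less_mult_iff)
  have "(real n - 1) powr (3 / 2) = ((real n - 1) powr 3) powr (1 / 2)"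
    by (simp add: powr_powr)
  also have "\<dots> = sqrt ((real n - 1) ^ 3)"
    using n by (simp add: powr_half_sqrt)
  also have "\<dots> \<le> sqrt ((P $ i $ i)\<^sup>2 * m4)"
    using le by simp
  also have "\<dots> = P $ i $ i * sqrt m4"
    using pos_semidef_diag_nonneg[OF P] by (simp add: real_sqrt_mult)
  finally show ?thesis
    using m4 by (simp add: vertex_seidel_energy_def divide_le_eq flip: S_def P_def m4_def)
qed

end
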